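(* Let $(\phi,\psi)$ be a solution on $(0,T)$ of the projected Allen–Cahn system with projected Allen–Cahn type dynamic boundary condition $$\phi_t=-\gamma_1\,\mathbf{P}_1\mu \ \text{ in } \Omega\times(0,T),\qquad \mu=-\kappa^2\Delta\phi+f(\phi)\ \text{ in }\Omega\times(0,T),\qquad \partial_{\mathbf n}\mu=0 \ \text{ on }\Gamma\times(0,T),$$ $$\phi|_\Gamma=\psi\ \text{ on }\Gamma\times(0,T),\qquad \psi_t=-\gamma_2\,\mathbf{P}_2\mu_\Gamma\ \text{ on }\Gamma\times(0,T),\qquad \mu_\Gamma=-\kappa^2\Delta_\Gamma\psi+g(\psi)+\kappa^2\partial_{\mathbf n}\phi\ \text{ on }\Gamma\times(0,T).$$ Then mass is conserved both in the bulk and on the surface: for all $t\in(0,T)$, $$\frac{\mathrm d}{\mathrm dt}\int_\Omega\phi\,\mathrm d\mathbf x=0,\qquad \frac{\mathrm d}{\mathrm dt}\int_\Gamma\psi\,\mathrm dS=0.$$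
   Context: $\Omega\subset\mathbb R^d$ is a bounded domain with boundary $\Gamma$, smooth enough for the Gauss–Green formulas in $\Omega$ and on the closed hypersurface $\Gamma$; $\mathbf n$ is the outward unit normal to $\Gamma$; $T>0$ is finite; $\gamma_1,\gamma_2,\kappa>0$ are constants. $\nabla_\Gamma$ and $\Delta_\Gamma$ denote the tangential gradient and the Laplace–Beltrami operator on $\Gamma$. The unknowns are $\phi:\Omega\times(0,T)\to\mathbb R$ and $\psi:\Gamma\times(0,T)\to\mathbb R$; solutions are understood to be smooth enough that all expressions make classical sense (including differentiation in time under the integral). The nonlinearities are $f=F'$ with $F(\phi)=\tfrac14(\phi^2-1)^2$, i.e. $f(\phi)=\phi^3-\phi$, and $g=G'$, where the surface potential $G$ is either the double-well potential $G(\psi)=\tfrac14(\psi^2-1)^2$ or the moving contact line potential $G(\psi)=-\tfrac{\tilde\gamma}{2}\cos(\theta_s)\sin(\tfrac{\pi}{2}\psi)$ with real constants $\tilde\gamma,\theta_s$. The projections are $$\mathbf P_1u:=u-\frac1{|\Omega|}\int_\Omega u(\mathbf x)\,\mathrm d\mathbf x\quad(u\in L^2(\Omega)),\qquad \mathbf P_2u:=u-\frac1{|\Gamma|}\int_\Gamma u\,\mathrm dS\quad(u\in L^2(\Gamma)),$$ where $|\Omega|$ is the volume of $\Omega$ and $|\Gamma|$ the surface measure of $\Gamma$. *)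

theory Defs
  imports "HOL-Analysis.Analysis"
begin

section \<open>Classical derivatives in the bulk\<close>

definition partial_deriv :: "'a::euclidean_space \<Rightarrow> ('a \<Rightarrow> real) \<Rightarrow> 'a \<Rightarrow> real" where
  "partial_deriv b u x = frechet_derivative u (at x) b"

definition laplacian :: "('a::euclidean_space \<Rightarrow> real) \<Rightarrow> 'a \<Rightarrow> real" where
  "laplacian u x = (\<Sum>b\<in>Basis. partial_deriv b (partial_deriv b u) x)"

definition extends_to_closure :: "'a::topological_space set \<Rightarrow> ('a \<Rightarrow> real) \<Rightarrow> bool" where
  "extends_to_closure S u \<longleftrightarrow> (\<exists>v. continuous_on (closure S) v \<and> (\<forall>x\<in>S. v x = u x))"

text \<open>For open \<open>S\<close>, membership in the usual space of functions that are \<open>k\<close> times continuously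
  differentiable on \<open>S\<close>, all derivatives of order at most \<open>k\<close> extending continuously to the
  closure of \<open>S\<close>. For \<open>S = UNIV\<close> these are just the \<open>k\<close> times continuously differentiable
  functions. Only the values of \<open>u\<close> on \<open>S\<close> matter.\<close>

primrec Ck_closure :: "nat \<Rightarrow> 'a::euclidean_space set \<Rightarrow> ('a \<Rightarrow> real) \<Rightarrow> bool" where
  "Ck_closure 0 S u \<longleftrightarrow> extends_to_closure S u"
| "Ck_closure (Suc k) S u \<longleftrightarrow> extends_to_closure S u \<and> (\<forall>x\<in>S. u differentiable (at x)) \<and>
     (\<forall>b\<in>Basis. Ck_closure k S (partial_deriv b u))"


section \<open>Bounded domains with boundary of class \<open>C\<^sup>2\<close>\<close>

text \<open>Near each boundary point, and with respect to a suitable direction \<open>e\<close>, the domain lies below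
  the graph of a \<open>C\<^sup>2\<close> function \<open>h\<close> over the hyperplane orthogonal to \<open>e\<close>. Only the values of \<open>h\<close>
  on that hyperplane matter; a \<open>C\<^sup>2\<close> function on the hyperplane extends to the whole space by making
  it constant in the direction \<open>e\<close>.\<close>

definition C2_bounded_domain :: "'a::euclidean_space set \<Rightarrow> bool" where
  "C2_bounded_domain \<Omega> \<longleftrightarrow>
     open \<Omega> \<and> connected \<Omega> \<and> \<Omega> \<noteq> {} \<and> bounded \<Omega> \<and>
     (\<forall>x\<in>frontier \<Omega>. \<exists>r>0. \<exists>e h. norm e = 1 \<and> Ck_closure 2 UNIV h \<and>
        \<Omega> \<inter> ball x r = {y \<in> ball x r. y \<bullet> e < h (y - (y \<bullet> e) *\<^sub>R e)})"

text \<open>The unit vector that is orthogonal to the boundary at \<open>x\<close> (chords of the boundary through \<open>x\<close>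
  become orthogonal to it in the limit) and points from the domain to its exterior. In dimension one
  the frontier is discrete and orthogonality is vacuous, as it should be.\<close>

definition outward_normal :: "'a::euclidean_space set \<Rightarrow> 'a \<Rightarrow> 'a" where
  "outward_normal \<Omega> x = (THE \<nu>. norm \<nu> = 1 \<and>
     ((\<lambda>y. ((y - x) \<bullet> \<nu>) / norm (y - x)) \<longlongrightarrow> 0) (at x within frontier \<Omega>) \<and>
     (\<forall>\<^sub>F s in at_right 0. x - s *\<^sub>R \<nu> \<in> \<Omega> \<and> x + s *\<^sub>R \<nu> \<notin> closure \<Omega>))"

text \<open>The outward normal derivative at a boundary point is the one-sided derivative from inside, so
  \<open>u\<close> is evaluated on \<open>\<Omega>\<close> and at the boundary point only.\<close>

definition normal_deriv :: "'a::euclidean_space set \<Rightarrow> ('a \<Rightarrow> real) \<Rightarrow> 'a \<Rightarrow> real" where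
  "normal_deriv \<Omega> u x = Lim (at_right 0) (\<lambda>s. (u x - u (x - s *\<^sub>R outward_normal \<Omega> x)) / s)"


section \<open>Tangential calculus on the boundary\<close>

text \<open>The derivative of \<open>u\<close> at \<open>x\<close> within the hypersurface determines the gradient only up to a normal
  component; the tangential gradient is the representative orthogonal to the normal. It coincides
  with the tangential part of the gradient of any differentiable extension of \<open>u\<close>.\<close>

definition tangential_gradient :: "'a::euclidean_space set \<Rightarrow> ('a \<Rightarrow> real) \<Rightarrow> 'a \<Rightarrow> 'a" where
  "tangential_gradient \<Omega> u x = (THE v. v \<bullet> outward_normal \<Omega> x = 0 \<and>
     (u has_derivative (\<lambda>h. v \<bullet> h)) (at x within frontier \<Omega>))"

text \<open>The surface divergence of the tangential gradient.\<close>

definition laplace_beltrami :: "'a::euclidean_space set \<Rightarrow> ('a \<Rightarrow> real) \<Rightarrow> 'a \<Rightarrow> real" where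
  "laplace_beltrami \<Omega> u x =
     (\<Sum>b\<in>Basis. tangential_gradient \<Omega> (\<lambda>y. tangential_gradient \<Omega> u y \<bullet> b) x \<bullet> b)"

definition C1_on_boundary :: "'a::euclidean_space set \<Rightarrow> ('a \<Rightarrow> real) \<Rightarrow> bool" where
  "C1_on_boundary \<Omega> u \<longleftrightarrow> (\<forall>x\<in>frontier \<Omega>. u differentiable (at x within frontier \<Omega>)) \<and>
     continuous_on (frontier \<Omega>) (tangential_gradient \<Omega> u)"

definition C2_on_boundary :: "'a::euclidean_space set \<Rightarrow> ('a \<Rightarrow> real) \<Rightarrow> bool" where
  "C2_on_boundary \<Omega> u \<longleftrightarrow> C1_on_boundary \<Omega> u \<and>
     (\<forall>b\<in>Basis. C1_on_boundary \<Omega> (\<lambda>x. tangential_gradient \<Omega> u x \<bullet> b))"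


section \<open>Surface measure\<close>

text \<open>The \<open>s\<close>-dimensional Hausdorff measure on the Borel sets, normalised to agree with Lebesgue
  measure in dimension \<open>s\<close>. Empty covering sets get weight 0 explicitly because \<open>0 ^ 0 = 1\<close>.
  The set function is a metric outer measure, hence countably additive on the Borel sets by
  Caratheodory's criterion, so the side condition of \<open>measure_of\<close> is met.\<close>

definition hausdorff_content :: "nat \<Rightarrow> real \<Rightarrow> 'a::metric_space set \<Rightarrow> ennreal" where
  "hausdorff_content s \<delta> A =
     (INF U\<in>{U :: nat \<Rightarrow> 'a set. A \<subseteq> (\<Union>i. U i) \<and> (\<forall>i. bounded (U i) \<and> diameter (U i) \<le> \<delta>)}.
        (\<Sum>i. if U i = {} then 0
              else ennreal (unit_ball_vol (real s) * (diameter (U i) / 2) ^ s)))"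

definition hausdorff_measure :: "nat \<Rightarrow> 'a::metric_space measure" where
  "hausdorff_measure s = measure_of UNIV (sets borel) (\<lambda>A. SUP \<delta>\<in>{0<..}. hausdorff_content s \<delta> A)"

definition surface_measure :: "'a::euclidean_space measure" where
  "surface_measure = hausdorff_measure (DIM('a) - 1)"


section \<open>Potentials and projections\<close>

definition double_well :: "real \<Rightarrow> real" where
  "double_well s = 1/4 * (s\<^sup>2 - 1)\<^sup>2"

definition contact_line_potential :: "real \<Rightarrow> real \<Rightarrow> real \<Rightarrow> real" where
  "contact_line_potential \<gamma> \<theta> s = - (\<gamma> / 2) * cos \<theta> * sin (pi / 2 * s)"

lemma deriv_double_well: "deriv double_well = (\<lambda>s. s ^ 3 - s)"
proof
  fix s :: real
  have "(double_well has_real_derivative s ^ 3 - s) (at s)"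
    unfolding double_well_def
    by (rule derivative_eq_intros refl | simp add: power2_eq_square power3_eq_cube algebra_simps)+
  then show "deriv double_well s = s ^ 3 - s"
    by (rule DERIV_imp_deriv)
qed

definition mean_free_part :: "'a measure \<Rightarrow> 'a set \<Rightarrow> ('a \<Rightarrow> real) \<Rightarrow> 'a \<Rightarrow> real" where
  "mean_free_part M A u x = u x - 1 / measure M A * (LINT y:A|M. u y)"

abbreviation bulk_projection :: "'a::euclidean_space set \<Rightarrow> ('a \<Rightarrow> real) \<Rightarrow> 'a \<Rightarrow> real" where
  "bulk_projection \<Omega> \<equiv> mean_free_part lborel \<Omega>"

abbreviation surface_projection :: "'a::euclidean_space set \<Rightarrow> ('a \<Rightarrow> real) \<Rightarrow> 'a \<Rightarrow> real" where
  "surface_projection \<Omega> \<equiv> mean_free_part surface_measure (frontier \<Omega>)"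


section \<open>Regularity of classical solutions\<close>

definition C1_in_time :: "real \<Rightarrow> 'a::topological_space set \<Rightarrow> (real \<Rightarrow> 'a \<Rightarrow> real) \<Rightarrow> bool" where
  "C1_in_time T K u \<longleftrightarrow>
     (\<forall>t\<in>{0<..<T}. \<forall>x\<in>K. (\<lambda>s. u s x) differentiable (at t)) \<and>
     continuous_on ({0<..<T} \<times> K) (\<lambda>(t, x). u t x) \<and>
     continuous_on ({0<..<T} \<times> K) (\<lambda>(t, x). deriv (\<lambda>s. u s x) t)"

text \<open>The bulk quantities \<open>\<phi>\<close> and \<open>\<mu>\<close> are identified with their continuous extensions to the closure
  of \<open>\<Omega>\<close>, so that boundary values are literally values on the frontier.\<close>

definition classical_regularity ::
  "'a::euclidean_space set \<Rightarrow> real \<Rightarrow> (real \<Rightarrow> 'a \<Rightarrow> real) \<Rightarrow> (real \<Rightarrow> 'a \<Rightarrow> real) \<Rightarrow>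
   (real \<Rightarrow> 'a \<Rightarrow> real) \<Rightarrow> bool" where
  "classical_regularity \<Omega> T \<phi> \<psi> \<mu> \<longleftrightarrow>
     C1_in_time T (closure \<Omega>) \<phi> \<and> C1_in_time T (frontier \<Omega>) \<psi> \<and>
     (\<forall>t\<in>{0<..<T}. Ck_closure 2 \<Omega> (\<phi> t) \<and>
        Ck_closure 1 \<Omega> (\<mu> t) \<and> continuous_on (closure \<Omega>) (\<mu> t) \<and>
        C2_on_boundary \<Omega> (\<psi> t))"

end

(*
  Both equations have the form u_t = - gamma * (w - mean of w), and the integral of w minus its mean
  vanishes, so only differentiation under the integral sign is needed. It is available because u_t is
  continuous in space-time and the domain of integration is bounded with finite measure. For the
  surface this means that the boundary has finite Hausdorff measure: locally it is a Lipschitz graph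
  over a ball of a hyperplane, and the part of the graph above a grid of N^(d-1) cells is covered by
  N^(d-1) sets of diameter O(1/N).
*)
theory Submission
  imports Defs
begin

section \<open>Covering estimates for Hausdorff measure, and the boundary as a finite union of
  Lipschitz graphs\<close>

section \<open>Finiteness of the surface measure\<close>

text \<open>The fibres of the labelling \<open>q\<close> on \<open>A\<close> serve as the cover:
  there are at most \<open>m\<close> of them, each of diameter at most \<open>D\<close>.\<close>

lemma hausdorff_content_le_card:
  fixes A :: "'a::metric_space set" and q :: "'a \<Rightarrow> 'b"
  assumes fin: "finite (q ` A)" and card: "card (q ` A) \<le> m"
    and D: "\<And>x y. x \<in> A \<Longrightarrow> y \<in> A \<Longrightarrow> q x = q y \<Longrightarrow> dist x y \<le> D" "0 \<le> D" "D \<le> \<delta>"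
  shows "hausdorff_content s \<delta> A \<le> ennreal (real m * (unit_ball_vol (real s) * (D / 2) ^ s))"
proof -
  define n where "n = card (q ` A)"
  obtain f where f: "bij_betw f {..<n} (q ` A)"
    using ex_bij_betw_nat_finite[OF fin] unfolding n_def atLeast0LessThan by blast
  \<comment> \<open>Covers are sequences indexed by all of \<open>nat\<close>, so the
    \<open>n\<close> fibres are padded with empty sets. These have weight 0 even for
    \<open>s = 0\<close>, which keeps the series a finite sum.\<close>
  define U where "U i = (if i < n then {x \<in> A. q x = f i} else {})" for i
  have "A \<subseteq> (\<Union>i. U i)"
  proof
    fix x assume "x \<in> A"
    then obtain i where "i < n" "q x = f i"
      using f unfolding bij_betw_def by (metis imageE imageI lessThan_iff)
    with \<open>x \<in> A\<close> show "x \<in> (\<Union>i. U i)"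
      by (auto simp: U_def)
  qed
  moreover have dist_U: "dist x y \<le> D" if "x \<in> U i" "y \<in> U i" for x y i
    using that D(1) by (auto simp: U_def split: if_splits)
  moreover have bdd: "bounded (U i)" for i
    using dist_U unfolding bounded_def by (cases "U i = {}") blast+
  moreover have diam: "diameter (U i) \<le> D" for i
    using dist_U D(2) by (auto simp: diameter_def intro!: cSUP_least)
  ultimately have "hausdorff_content s \<delta> A \<le>
      (\<Sum>i. if U i = {} then 0 else ennreal (unit_ball_vol (real s) * (diameter (U i) / 2) ^ s))"
    using order_trans[OF _ D(3)] unfolding hausdorff_content_def by (intro INF_lower) auto
  also have "\<dots> = (\<Sum>i<n. if U i = {} then 0 else ennreal (unit_ball_vol (real s) * (diameter (U i) / 2) ^ s))"
    by (rule suminf_finite) (auto simp: U_def)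
  also have "\<dots> \<le> (\<Sum>i<n. ennreal (unit_ball_vol (real s) * (D / 2) ^ s))"
    using diam bdd D(2)
    by (intro sum_mono) (auto intro!: ennreal_leI mult_left_mono power_mono diameter_ge_0)
  also have "\<dots> = ennreal (real n * (unit_ball_vol (real s) * (D / 2) ^ s))"
    using D(2) by (simp add: ennreal_mult' ennreal_of_nat_eq_real_of_nat)
  also have "\<dots> \<le> ennreal (real m * (unit_ball_vol (real s) * (D / 2) ^ s))"
    using card D(2) unfolding n_def by (intro ennreal_leI mult_right_mono) auto
  finally show ?thesis .
qed

text \<open>By \<open>lip\<close>, points of \<open>A\<close> are controlled by their coordinates
  along \<open>B\<close>. Cutting these coordinates into cells of side \<open>1 / N\<close> gives on
  the order of \<open>N ^ card B\<close> pieces of diameter at most a constant over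
  \<open>N\<close>. The powers of \<open>N\<close> cancel, so the bound does not depend on
  \<delta>.\<close>

lemma hausdorff_content_grid_bound:
  fixes A :: "'a::euclidean_space set" and L :: real
  assumes B: "finite B" and L: "0 \<le> L"
    and lip: "\<And>x y. x \<in> A \<Longrightarrow> y \<in> A \<Longrightarrow> norm (x - y) \<le> L * (\<Sum>b\<in>B. \<bar>x \<bullet> b - y \<bullet> b\<bar>)"
    and R: "R \<ge> 1" "\<And>x b. x \<in> A \<Longrightarrow> b \<in> B \<Longrightarrow> \<bar>x \<bullet> b\<bar> \<le> real R"
    and "0 < \<delta>"
  shows "hausdorff_content (card B) \<delta> A
    \<le> ennreal (unit_ball_vol (real (card B)) * (3 * R * L * card B / 2) ^ card B)"
proof -
  define s where "s = card B"
  \<comment> \<open>The mesh must be fine enough that the piece diameter \<open>L * s / N\<close>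
    stays below \<delta>; being at least 1 allows division by \<open>N\<close> and the rounding of
    the cell count.\<close>
  obtain N :: nat where "max 1 (L * s / \<delta>) < N"
    using reals_Archimedean2 by blast
  then have N: "N > L * s / \<delta>" "N \<ge> 1"
    by auto
  \<comment> \<open>The label of a point is the integer index of its cell; \<open>restrict\<close>
    fixes the values off \<open>B\<close>, so that labels lie in a finite
    \<open>PiE\<close>.\<close>
  define q where "q x = restrict (\<lambda>b. \<lfloor>(x \<bullet> b) * N\<rfloor>) B" for x
  define D where "D = L * s / N"
  have qA: "q ` A \<subseteq> PiE B (\<lambda>_. {- int (R * N)..int (R * N)})"
  proof (intro image_subsetI)
    fix x assume "x \<in> A"
    have "\<lfloor>(x \<bullet> b) * N\<rfloor> \<in> {- int (R * N)..int (R * N)}" if "b \<in> B" for b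
    proof -
      have "\<bar>(x \<bullet> b) * N\<bar> \<le> real R * N"
        using R(2)[OF \<open>x \<in> A\<close> that] by (auto simp: abs_mult intro: mult_right_mono)
      then have "- real_of_int (int (R * N)) \<le> (x \<bullet> b) * N" "(x \<bullet> b) * N \<le> real_of_int (int (R * N))"
        by auto
      then show ?thesis
        by (simp add: le_floor_iff floor_le_iff)
    qed
    then show "q x \<in> PiE B (\<lambda>_. {- int (R * N)..int (R * N)})"
      by (auto simp: q_def)
  qed
  have fin: "finite (PiE B (\<lambda>_. {- int (R * N)..int (R * N)}))"
    using B by (intro finite_PiE) auto
  have "card (q ` A) \<le> card (PiE B (\<lambda>_. {- int (R * N)..int (R * N)}))"
    using qA fin by (rule card_mono[rotated])
  also have "\<dots> = (2 * R * N + 1) ^ s"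
    using B by (simp add: card_PiE s_def nat_add_distrib nat_mult_distrib algebra_simps)
  \<comment> \<open>Each coordinate has \<open>2 * R * N + 1\<close> possible indices. Absorbing the
    1 into another \<open>R * N\<close> makes the count a pure power of \<open>N\<close>.\<close>
  also have "\<dots> \<le> (3 * R * N) ^ s"
    using R(1) N(2) by (intro power_mono) auto
  finally have card: "card (q ` A) \<le> (3 * R * N) ^ s" .
  have "dist x y \<le> D" if "x \<in> A" "y \<in> A" "q x = q y" for x y
  proof -
    have "\<bar>x \<bullet> b - y \<bullet> b\<bar> \<le> 1 / N" if "b \<in> B" for b
    proof -
      have "\<lfloor>(x \<bullet> b) * N\<rfloor> = \<lfloor>(y \<bullet> b) * N\<rfloor>"
        using fun_cong[OF \<open>q x = q y\<close>, of b] that by (simp add: q_def)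
      then have "\<bar>(x \<bullet> b) * N - (y \<bullet> b) * N\<bar> \<le> 1"
        by linarith
      then have "\<bar>x \<bullet> b - y \<bullet> b\<bar> * N \<le> 1"
        by (simp add: left_diff_distrib[symmetric] abs_mult)
      then show ?thesis
        using N(2) by (simp add: field_simps)
    qed
    then have "(\<Sum>b\<in>B. \<bar>x \<bullet> b - y \<bullet> b\<bar>) \<le> s * (1 / N)"
      unfolding s_def by (rule sum_bounded_above)
    then have "L * (\<Sum>b\<in>B. \<bar>x \<bullet> b - y \<bullet> b\<bar>) \<le> L * (s * (1 / N))"
      using L by (rule mult_left_mono)
    with lip[OF that(1,2)] show ?thesis
      by (simp add: D_def dist_norm)
  qed
  moreover have "0 \<le> D"
    using L by (simp add: D_def)
  moreover have "D \<le> \<delta>"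
    using N \<open>0 < \<delta>\<close> by (simp add: D_def field_simps)
  ultimately have "hausdorff_content s \<delta> A
      \<le> ennreal (real ((3 * R * N) ^ s) * (unit_ball_vol (real s) * (D / 2) ^ s))"
    using finite_subset[OF qA fin] card by (intro hausdorff_content_le_card) auto
  also have "real ((3 * R * N) ^ s) * (unit_ball_vol (real s) * (D / 2) ^ s)
      = unit_ball_vol (real s) * (3 * R * N * (D / 2)) ^ s"
    by (simp only: power_mult_distrib of_nat_power of_nat_mult mult.assoc mult.left_commute[of _ "unit_ball_vol (real s)"])
  \<comment> \<open>Here \<open>N\<close>, and with it the dependence on \<delta>, drops
    out.\<close>
  also have "3 * R * N * (D / 2) = 3 * R * L * s / 2"
    using N(2) by (simp add: D_def)
  finally show ?thesis
    by (simp add: s_def)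
qed

text \<open>If the set function failed to be a measure, \<open>measure_of\<close> would be the zero measure, so this
  inequality does not depend on countable additivity.\<close>

lemma emeasure_hausdorff_measure_le:
  "emeasure (hausdorff_measure s) A \<le> (SUP \<delta>\<in>{0<..}. hausdorff_content s \<delta> A)"
  unfolding hausdorff_measure_def by (subst emeasure_measure_of_conv) auto

lemma sets_surface_measure [simp]: "sets surface_measure = sets borel"
  unfolding surface_measure_def hausdorff_measure_def
  using sets.sigma_sets_eq[of borel] by simp

lemma extends_to_closure_UNIV: "extends_to_closure UNIV u \<longleftrightarrow> continuous_on UNIV u"
proof
  assume "extends_to_closure UNIV u"
  then obtain v where "continuous_on UNIV v" "\<And>x. v x = u x"
    by (auto simp: extends_to_closure_def)
  moreover from this have "v = u"
    by blast
  ultimately show "continuous_on UNIV u"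
    by simp
qed (auto simp: extends_to_closure_def)

lemma Ck_closure_UNIV_D:
  assumes "Ck_closure (Suc (Suc 0)) UNIV h"
  shows "h differentiable (at x)" "b \<in> Basis \<Longrightarrow> continuous_on UNIV (partial_deriv b h)"
  using assms by (auto simp: extends_to_closure_UNIV)

text \<open>Continuous partial derivatives are bounded on the compact ball, which bounds the
  operator norm of the derivative there; convexity of the ball then allows the mean value
  inequality.\<close>

lemma Lipschitz_on_cball_if_continuous_partial_deriv:
  fixes h :: "'a::euclidean_space \<Rightarrow> real"
  assumes diff: "\<And>x. h differentiable (at x)"
    and cont: "\<And>b. b \<in> Basis \<Longrightarrow> continuous_on UNIV (partial_deriv b h)"
  obtains L where "0 \<le> L"
    "\<And>x y. x \<in> cball 0 R \<Longrightarrow> y \<in> cball 0 R \<Longrightarrow> \<bar>h x - h y\<bar> \<le> L * norm (x - y)"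
proof -
  have "\<exists>M. \<forall>x\<in>cball 0 R. \<bar>partial_deriv b h x\<bar> \<le> M" if "b \<in> Basis" for b
  proof -
    have "bounded (partial_deriv b h ` cball 0 R)"
      using continuous_on_subset[OF cont[OF that]]
      by (intro compact_imp_bounded compact_continuous_image) auto
    then show ?thesis
      by (auto simp: bounded_iff)
  qed
  then obtain M where M: "\<And>b x. b \<in> Basis \<Longrightarrow> x \<in> cball 0 R \<Longrightarrow> \<bar>partial_deriv b h x\<bar> \<le> M b"
    by metis
  \<comment> \<open>The absolute value secures \<open>0 \<le> L\<close> also for negative
    \<open>R\<close>, where the ball is empty and \<open>M\<close> is arbitrary.\<close>
  define L where "L = \<bar>\<Sum>b\<in>Basis. M b\<bar>"
  have der: "(h has_derivative frechet_derivative h (at x)) (at x within cball 0 R)" for x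
    using diff[of x] frechet_derivative_works has_derivative_at_withinI by blast
  have "onorm (frechet_derivative h (at x)) \<le> L" if x: "x \<in> cball 0 R" for x
  proof (rule onorm_bound)
    fix v :: 'a
    interpret linear "frechet_derivative h (at x)"
      using diff[of x] by (rule linear_frechet_derivative)
    have "frechet_derivative h (at x) v = frechet_derivative h (at x) (\<Sum>b\<in>Basis. (v \<bullet> b) *\<^sub>R b)"
      by (simp add: euclidean_representation)
    also have "\<dots> = (\<Sum>b\<in>Basis. (v \<bullet> b) * partial_deriv b h x)"
      by (simp add: sum scale partial_deriv_def)
    also have "norm \<dots> \<le> (\<Sum>b\<in>Basis. norm v * M b)"
      using M[OF _ x] by (intro sum_norm_le) (auto simp: abs_mult Basis_le_norm intro!: mult_mono)
    also have "\<dots> \<le> L * norm v"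
      unfolding L_def sum_distrib_left[symmetric] mult.commute[of _ "norm v"]
      by (intro mult_left_mono) auto
    finally show "norm (frechet_derivative h (at x) v) \<le> L * norm v" .
  qed (simp add: L_def)
  then have "\<bar>h x - h y\<bar> \<le> L * norm (x - y)" if "x \<in> cball 0 R" "y \<in> cball 0 R" for x y
    using differentiable_bound[of "cball 0 R" h "\<lambda>x. frechet_derivative h (at x)" L x y] der that
    by auto
  with that[of L] show thesis
    by (auto simp: L_def)
qed

text \<open>Points strictly below the graph lie in \<Omega>, which is open and so misses its
  frontier. Points strictly above have a neighbourhood disjoint from \<Omega>, so they are not in
  its closure.\<close>

lemma frontier_subgraph_subset_graph:
  fixes \<Omega> :: "'a::euclidean_space set"
  assumes "open \<Omega>" and h: "continuous_on UNIV h"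
    and graph: "\<Omega> \<inter> ball x r = {y \<in> ball x r. y \<bullet> e < h (y - (y \<bullet> e) *\<^sub>R e)}"
    and y: "y \<in> frontier \<Omega>" "y \<in> ball x r"
  shows "y \<bullet> e = h (y - (y \<bullet> e) *\<^sub>R e)"
proof (rule ccontr)
  assume neq: "y \<bullet> e \<noteq> h (y - (y \<bullet> e) *\<^sub>R e)"
  have "y \<notin> \<Omega>" "y \<in> closure \<Omega>"
    using y(1) \<open>open \<Omega>\<close> by (auto simp: frontier_def interior_open)
  with y(2) graph neq have "y \<bullet> e > h (y - (y \<bullet> e) *\<^sub>R e)"
    by fastforce
  moreover have "open {z. h (z - (z \<bullet> e) *\<^sub>R e) < z \<bullet> e}"
    by (intro open_Collect_less continuous_intros continuous_on_compose2[OF h]) auto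
  ultimately have "({z. h (z - (z \<bullet> e) *\<^sub>R e) < z \<bullet> e} \<inter> ball x r) \<inter> \<Omega> \<noteq> {}"
    using y(2) \<open>y \<in> closure \<Omega>\<close> open_Int_closure_eq_empty[OF open_Int[OF _ open_ball]] by blast
  with graph show False
    by force
qed

text \<open>On a graph over the hyperplane orthogonal to \<open>e\<close>, the height is a Lipschitz
  function of the projection \<open>P\<close>. Distances in \<open>A\<close> are therefore
  controlled by the coordinates in an orthonormal basis \<open>B\<close> of that hyperplane, and the
  grid bound applies.\<close>

lemma emeasure_surface_measure_graph_finite:
  fixes A :: "'a::euclidean_space set"
  assumes "bounded A" "norm e = 1" and h: "Ck_closure 2 UNIV h"
    and graph: "\<And>y. y \<in> A \<Longrightarrow> y \<bullet> e = h (y - (y \<bullet> e) *\<^sub>R e)"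
  shows "emeasure surface_measure A < \<infinity>"
proof -
  define P where "P y = y - (y \<bullet> e) *\<^sub>R e" for y
  have ee: "e \<bullet> e = 1"
    using \<open>norm e = 1\<close> by (simp add: norm_eq_1)
  have Pe: "P y \<in> {z. e \<bullet> z = 0}" for y
    using ee by (simp add: P_def inner_diff_right inner_commute)
  obtain B where B: "B \<subseteq> {z. e \<bullet> z = 0}" "pairwise orthogonal B" "\<And>b. b \<in> B \<Longrightarrow> norm b = 1"
      "independent B" "card B = dim {z. e \<bullet> z = 0}" "span B = {z. e \<bullet> z = 0}"
    using orthonormal_basis_subspace[OF subspace_hyperplane[of e]] by metis
  have finB: "finite B"
    using B(4) independent_imp_finite by blast
  \<comment> \<open>This matches the exponent of the grid bound with the dimension of
    \<open>surface_measure\<close>.\<close>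
  have cardB: "card B = DIM('a) - 1"
    using B(5) dim_hyperplane[of e] \<open>norm e = 1\<close> by fastforce
  obtain R0 where R0: "\<And>y. y \<in> A \<Longrightarrow> norm y \<le> R0"
    using \<open>bounded A\<close> by (auto simp: bounded_iff)
  obtain R :: nat where R: "real R \<ge> max 1 R0"
    using real_arch_simple by blast
  have "\<And>x. h differentiable (at x)" "\<And>b. b \<in> Basis \<Longrightarrow> continuous_on UNIV (partial_deriv b h)"
    using Ck_closure_UNIV_D[of h] h by (auto simp: numeral_2_eq_2)
  \<comment> \<open>The radius \<open>2 * R\<close> comes from the crude estimate
    \<open>norm (P y) \<le> norm y + \<bar>y \<bullet> e\<bar>\<close>.\<close>
  then obtain L where L: "0 \<le> L"
    "\<And>x y. x \<in> cball 0 (2 * R) \<Longrightarrow> y \<in> cball 0 (2 * R) \<Longrightarrow> \<bar>h x - h y\<bar> \<le> L * norm (x - y)"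
    using Lipschitz_on_cball_if_continuous_partial_deriv by blast
  have PA: "P y \<in> cball 0 (2 * R)" if "y \<in> A" for y
  proof -
    have "norm (P y) \<le> norm y + \<bar>y \<bullet> e\<bar>"
      unfolding P_def using norm_triangle_ineq4[of y "(y \<bullet> e) *\<^sub>R e"] \<open>norm e = 1\<close> by simp
    also have "\<bar>y \<bullet> e\<bar> \<le> norm y"
      using Cauchy_Schwarz_ineq2[of y e] \<open>norm e = 1\<close> by simp
    finally show ?thesis
      using R0[OF that] R by simp
  qed
  have lip: "norm (x - y) \<le> (1 + L) * (\<Sum>b\<in>B. \<bar>x \<bullet> b - y \<bullet> b\<bar>)" if "x \<in> A" "y \<in> A" for x y
  proof -
    have "P x - P y = P (x - y)"
      by (simp add: P_def algebra_simps)
    have "P (x - y) \<in> span B"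
      using Pe B(6) by auto
    then have "P (x - y) = (\<Sum>b\<in>B. (P (x - y) \<bullet> b) *\<^sub>R b)"
      using B(2,3) finB by (simp add: orthonormal_basis_expand)
    also have "norm \<dots> \<le> (\<Sum>b\<in>B. \<bar>x \<bullet> b - y \<bullet> b\<bar>)"
      using B(1,3) by (intro sum_norm_le) (auto simp: P_def inner_diff_left)
    finally have 1: "norm (P x - P y) \<le> (\<Sum>b\<in>B. \<bar>x \<bullet> b - y \<bullet> b\<bar>)"
      using \<open>P x - P y = P (x - y)\<close> by simp
    have "x - y = (P x - P y) + (x \<bullet> e - y \<bullet> e) *\<^sub>R e"
      by (simp add: P_def algebra_simps)
    then have "norm (x - y) \<le> norm (P x - P y) + \<bar>x \<bullet> e - y \<bullet> e\<bar>"
      using norm_triangle_ineq[of "P x - P y" "(x \<bullet> e - y \<bullet> e) *\<^sub>R e"] \<open>norm e = 1\<close> by simp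
    also have "\<bar>x \<bullet> e - y \<bullet> e\<bar> \<le> L * norm (P x - P y)"
      using L(2)[OF PA PA] that graph unfolding P_def by metis
    finally have "norm (x - y) \<le> (1 + L) * norm (P x - P y)"
      by (simp add: algebra_simps)
    also have "\<dots> \<le> (1 + L) * (\<Sum>b\<in>B. \<bar>x \<bullet> b - y \<bullet> b\<bar>)"
      using 1 L(1) by (intro mult_left_mono) auto
    finally show ?thesis .
  qed
  have "\<bar>x \<bullet> b\<bar> \<le> real R" if "x \<in> A" "b \<in> B" for x b
    using Cauchy_Schwarz_ineq2[of x b] B(3)[OF that(2)] R0[OF that(1)] R by simp
  then have "hausdorff_content (card B) \<delta> A
      \<le> ennreal (unit_ball_vol (real (card B)) * (3 * R * (1 + L) * card B / 2) ^ card B)"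
    if "0 < \<delta>" for \<delta>
    using hausdorff_content_grid_bound[OF finB _ lip _ _ that, where R = R] L(1) R by auto
  \<comment> \<open>The bound is uniform in \<delta>, so it survives the supremum that defines the
    measure.\<close>
  then have "(SUP \<delta>\<in>{0<..}. hausdorff_content (card B) \<delta> A)
      \<le> ennreal (unit_ball_vol (real (card B)) * (3 * R * (1 + L) * card B / 2) ^ card B)"
    by (intro SUP_least) auto
  with emeasure_hausdorff_measure_le[of "card B" A] show ?thesis
    unfolding surface_measure_def cardB
    by (metis ennreal_less_top infinity_ennreal_def order.trans order_le_less_trans)
qed

text \<open>The frontier is compact, so finitely many of the balls in which it is a graph cover it;
  finite subadditivity then suffices.\<close>

lemma emeasure_surface_measure_frontier_finite:
  fixes \<Omega> :: "'a::euclidean_space set"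
  assumes "C2_bounded_domain \<Omega>"
  shows "emeasure surface_measure (frontier \<Omega>) < \<infinity>"
proof -
  have \<Omega>: "open \<Omega>" "bounded \<Omega>"
    using assms by (auto simp: C2_bounded_domain_def)
  have "\<exists>r>0. emeasure surface_measure (frontier \<Omega> \<inter> ball x r) < \<infinity>"
    if x: "x \<in> frontier \<Omega>" for x
  proof -
    obtain r e h where r: "r > 0" "norm e = 1" and h: "Ck_closure 2 UNIV h"
      and graph: "\<Omega> \<inter> ball x r = {y \<in> ball x r. y \<bullet> e < h (y - (y \<bullet> e) *\<^sub>R e)}"
      using assms x unfolding C2_bounded_domain_def by meson
    have "continuous_on UNIV h"
      using h by (simp add: numeral_2_eq_2 extends_to_closure_UNIV)
    then have "y \<bullet> e = h (y - (y \<bullet> e) *\<^sub>R e)" if "y \<in> frontier \<Omega> \<inter> ball x r" for y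
      using frontier_subgraph_subset_graph[OF \<Omega>(1) _ graph] that by blast
    moreover have "bounded (frontier \<Omega> \<inter> ball x r)"
      by (simp add: bounded_Int)
    ultimately have "emeasure surface_measure (frontier \<Omega> \<inter> ball x r) < \<infinity>"
      using r(2) h emeasure_surface_measure_graph_finite by blast
    with r(1) show ?thesis
      by blast
  qed
  then obtain r where r: "\<And>x. x \<in> frontier \<Omega> \<Longrightarrow> 0 < r x"
      "\<And>x. x \<in> frontier \<Omega> \<Longrightarrow> emeasure surface_measure (frontier \<Omega> \<inter> ball x (r x)) < \<infinity>"
    by metis
  have "compact (frontier \<Omega>)"
    using \<Omega>(2) by (rule compact_frontier_bounded)
  moreover have "frontier \<Omega> \<subseteq> (\<Union>x\<in>frontier \<Omega>. ball x (r x))"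
    using r(1) by force
  ultimately obtain C where C: "C \<subseteq> frontier \<Omega>" "finite C" "frontier \<Omega> \<subseteq> (\<Union>x\<in>C. ball x (r x))"
    using compactE_image[of "frontier \<Omega>" "frontier \<Omega>" "\<lambda>x. ball x (r x)"] by blast
  have "frontier \<Omega> = (\<Union>x\<in>C. frontier \<Omega> \<inter> ball x (r x))"
    using C(3) by auto
  then have "emeasure surface_measure (frontier \<Omega>)
      \<le> (\<Sum>x\<in>C. emeasure surface_measure (frontier \<Omega> \<inter> ball x (r x)))"
    using C(2) emeasure_subadditive_finite[of C "\<lambda>x. frontier \<Omega> \<inter> ball x (r x)" surface_measure]
    by (auto simp: image_subset_iff frontier_closed borel_closed)
  also have "\<dots> < \<infinity>"
    using C(1,2) r(2) by (auto simp: ennreal_sum_less_top subset_iff)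
  finally show ?thesis .
qed


section \<open>Time derivatives of integrals over sets of finite measure\<close>

section \<open>Differentiation under the integral sign\<close>

text \<open>The set of integration \<open>A\<close> is kept apart from the compact set
  \<open>K\<close> that supplies boundedness: in the bulk \<open>A\<close> is open and
  \<open>K\<close> is its closure.\<close>

lemma set_integrable_continuous_on_finite_measure:
  fixes w :: "'a::topological_space \<Rightarrow> real"
  assumes M: "sets M = sets borel" "A \<in> sets M" "emeasure M A < \<infinity>"
    and K: "compact K" "A \<subseteq> K" "continuous_on K w"
  shows "set_integrable M A w"
proof -
  have "bounded (w ` K)"
    using K by (intro compact_imp_bounded compact_continuous_image)
  then obtain B where B: "\<And>x. x \<in> K \<Longrightarrow> \<bar>w x\<bar> \<le> B"
    by (auto simp: bounded_iff)
  have "(\<lambda>x. indicator A x *\<^sub>R w x) \<in> borel_measurable borel"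
    using M continuous_on_subset[OF K(3,2)] by (intro borel_measurable_continuous_on_indicator) auto
  then have "(\<lambda>x. indicator A x *\<^sub>R w x) \<in> borel_measurable M"
    using measurable_cong_sets[OF M(1) refl] by blast
  then show ?thesis
    unfolding set_integrable_def using M B K(2)
    by (intro integrableI_bounded_set[of A _ _ B]) auto
qed

text \<open>The time derivative is uniformly continuous on a compact time interval times
  \<open>K\<close>, so the first-order Taylor remainder is small uniformly in
  \<open>x\<close>.\<close>

lemma C1_in_time_uniform_remainder:
  fixes u :: "real \<Rightarrow> 'a::metric_space \<Rightarrow> real"
  assumes u: "C1_in_time T K u" and K: "compact K" and t: "t \<in> {0<..<T}" and "e > 0"
  obtains d where "d > 0" "{t - d<..<t + d} \<subseteq> {0<..<T}"
    "\<And>s x. \<bar>s - t\<bar> < d \<Longrightarrow> x \<in> K \<Longrightarrow>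
       \<bar>u s x - u t x - (s - t) * deriv (\<lambda>s. u s x) t\<bar> \<le> e * \<bar>s - t\<bar>"
proof -
  \<comment> \<open>Half the distance to the nearer endpoint keeps the closed interval around
    \<open>t\<close>, needed for compactness, inside the open time interval.\<close>
  define \<eta> where "\<eta> = min t (T - t) / 2"
  have \<eta>: "\<eta> > 0" "{t - \<eta>..t + \<eta>} \<subseteq> {0<..<T}"
    using t by (auto simp: \<eta>_def min_def field_simps split: if_splits)
  have "continuous_on ({t - \<eta>..t + \<eta>} \<times> K) (\<lambda>(t, x). deriv (\<lambda>s. u s x) t)"
    using u \<eta>(2) unfolding C1_in_time_def by (meson Sigma_mono continuous_on_subset order_refl)
  then have "uniformly_continuous_on ({t - \<eta>..t + \<eta>} \<times> K) (\<lambda>(t, x). deriv (\<lambda>s. u s x) t)"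
    using K by (intro compact_uniformly_continuous compact_Times) auto
  then obtain \<delta> where \<delta>: "\<delta> > 0" "\<And>p p'. p \<in> {t - \<eta>..t + \<eta>} \<times> K \<Longrightarrow> p' \<in> {t - \<eta>..t + \<eta>} \<times> K \<Longrightarrow>
      dist p' p < \<delta> \<Longrightarrow> dist ((\<lambda>(t, x). deriv (\<lambda>s. u s x) t) p') ((\<lambda>(t, x). deriv (\<lambda>s. u s x) t) p) < e"
    using \<open>e > 0\<close> unfolding uniformly_continuous_on_def by metis
  define d where "d = min \<delta> \<eta>"
  have sub: "{t - d<..<t + d} \<subseteq> {0<..<T}"
  proof -
    have "{t - d<..<t + d} \<subseteq> {t - \<eta>..t + \<eta>}"
      by (auto simp: d_def)
    with \<eta>(2) show ?thesis
      by blast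
  qed
  have "\<bar>u s x - u t x - (s - t) * deriv (\<lambda>s. u s x) t\<bar> \<le> e * \<bar>s - t\<bar>"
    if "\<bar>s - t\<bar> < d" "x \<in> K" for s x
  proof -
    let ?v = "\<lambda>r. deriv (\<lambda>s. u s x) r"
    \<comment> \<open>With the linear part subtracted, the derivative is an increment of
      \<open>?v\<close>, hence at most \<open>e\<close> near \<open>t\<close>; the mean value
      inequality turns this into the remainder bound.\<close>
    have "((\<lambda>r. u r x - r * ?v t) has_field_derivative ?v r - ?v t) (at r within {t - d<..<t + d})"
      if "r \<in> {t - d<..<t + d}" for r
    proof -
      have "(\<lambda>s. u s x) differentiable (at r)"
        using u sub that \<open>x \<in> K\<close> unfolding C1_in_time_def by blast
      then have "((\<lambda>s. u s x) has_field_derivative ?v r) (at r)"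
        using DERIV_deriv_iff_real_differentiable by blast
      then have "((\<lambda>r. u r x - r * ?v t) has_field_derivative ?v r - ?v t) (at r)"
        by (auto intro!: derivative_eq_intros)
      then show ?thesis
        by (rule has_field_derivative_at_within)
    qed
    moreover have "norm (?v r - ?v t) \<le> e" if "r \<in> {t - d<..<t + d}" for r
    proof -
      have "\<bar>r - t\<bar> < \<delta>" "\<bar>r - t\<bar> < \<eta>"
        using that unfolding d_def by auto
      then show ?thesis
        using \<delta>(2)[of "(t, x)" "(r, x)"] \<open>x \<in> K\<close> \<eta>(1)
        by (force simp: dist_Pair_Pair dist_real_def abs_less_iff)
    qed
    ultimately have "norm ((u s x - s * ?v t) - (u t x - t * ?v t)) \<le> e * norm (s - t)"
      using that(1) \<eta>(1) \<delta>(1)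
      by (intro field_differentiable_bound[of "{t - d<..<t + d}"]) (auto simp: d_def)
    then show ?thesis
      by (simp add: algebra_simps)
  qed
  with that[of d] \<eta>(1) \<delta>(1) sub show thesis
    by (auto simp: d_def)
qed

lemma C1_in_time_continuous_on:
  assumes "C1_in_time T K u" "t \<in> {0<..<T}"
  shows "continuous_on K (u t)" "continuous_on K (\<lambda>x. deriv (\<lambda>s. u s x) t)"
proof -
  have "continuous_on K (\<lambda>x. (t, x))"
    by (intro continuous_intros)
  moreover have "(\<lambda>x. (t, x)) ` K \<subseteq> {0<..<T} \<times> K"
    using assms(2) by auto
  ultimately show "continuous_on K (u t)" "continuous_on K (\<lambda>x. deriv (\<lambda>s. u s x) t)"
    using assms(1) continuous_on_compose2[of "{0<..<T} \<times> K" _ K "\<lambda>x. (t, x)"]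
    unfolding C1_in_time_def by fastforce+
qed

text \<open>Integrating the uniform Taylor remainder over a set of finite measure leaves an error
  that is still small relative to the time increment.\<close>

lemma has_real_derivative_set_integral_C1_in_time:
  fixes u :: "real \<Rightarrow> 'a::metric_space \<Rightarrow> real"
  assumes M: "sets M = sets borel" "A \<in> sets M" "emeasure M A < \<infinity>"
    and K: "compact K" "A \<subseteq> K" and u: "C1_in_time T K u" and t: "t \<in> {0<..<T}"
  shows "((\<lambda>s. LINT x:A|M. u s x) has_real_derivative (LINT x:A|M. deriv (\<lambda>s. u s x) t)) (at t)"
proof -
  let ?v = "\<lambda>x. deriv (\<lambda>s. u s x) t"
  define m where "m = measure M A"
  have int: "set_integrable M A (u s)" "set_integrable M A (\<lambda>x. deriv (\<lambda>s. u s x) s)"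
    if "s \<in> {0<..<T}" for s
    using C1_in_time_continuous_on[OF u that] M K
    by (auto intro: set_integrable_continuous_on_finite_measure)
  have "\<exists>d>0. \<forall>s. norm (s - t) < d \<longrightarrow>
      norm ((LINT x:A|M. u s x) - (LINT x:A|M. u t x) - (LINT x:A|M. ?v x) * (s - t)) \<le> e * norm (s - t)"
    if "e > 0" for e
  proof -
    have "m \<ge> 0"
      by (simp add: m_def)
    \<comment> \<open>The denominator \<open>m + 1\<close> also covers \<open>m = 0\<close>, and
      \<open>m * (e / (m + 1)) \<le> e\<close>.\<close>
    then have "e / (m + 1) > 0"
      using that by (intro divide_pos_pos) auto
    then obtain d where d: "d > 0" "{t - d<..<t + d} \<subseteq> {0<..<T}"
      "\<And>s x. \<bar>s - t\<bar> < d \<Longrightarrow> x \<in> K \<Longrightarrow>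
         \<bar>u s x - u t x - (s - t) * ?v x\<bar> \<le> e / (m + 1) * \<bar>s - t\<bar>"
      using C1_in_time_uniform_remainder[OF u K(1) t] by metis
    have "norm ((LINT x:A|M. u s x) - (LINT x:A|M. u t x) - (LINT x:A|M. ?v x) * (s - t)) \<le> e * norm (s - t)"
      if s: "norm (s - t) < d" for s
    proof -
      have "s \<in> {t - d<..<t + d}"
        using s by auto
      then have sT: "s \<in> {0<..<T}"
        using d(2) by blast
      let ?w = "\<lambda>x. u s x - u t x - (s - t) * ?v x"
      let ?c = "e / (m + 1) * \<bar>s - t\<bar>"
      have w: "set_integrable M A ?w"
        using int[OF sT] int[OF t] by (intro set_integral_diff set_integrable_mult_right) auto
      have c: "set_integrable M A (\<lambda>_. ?c)"
        using M K by (intro set_integrable_continuous_on_finite_measure[of _ _ K]) auto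
      have "(LINT x:A|M. u s x) - (LINT x:A|M. u t x) - (LINT x:A|M. ?v x) * (s - t) = (LINT x:A|M. ?w x)"
        using int[OF sT] int[OF t] by (simp add: set_integral_diff mult.commute)
      also have "norm \<dots> \<le> (LINT x:A|M. norm (?w x))"
        using w by (rule set_integral_norm_bound)
      also have "\<dots> \<le> (LINT x:A|M. ?c)"
        using d(3)[of s] s K(2) set_integrable_norm[OF w] c
        by (intro set_integral_mono) (auto simp: subset_iff)
      also have "\<dots> = m * ?c"
        using M by (simp add: set_lebesgue_integral_def m_def)
      also have "\<dots> \<le> e * norm (s - t)"
        using \<open>m \<ge> 0\<close> \<open>e > 0\<close> by (simp add: field_simps mult_left_mono)
      finally show ?thesis .
    qed
    with d(1) show ?thesis
      by blast
  qed
  then show ?thesis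
    unfolding has_field_derivative_def has_derivative_at_alt
    by (auto intro: bounded_linear_mult_right)
qed


section \<open>Vanishing integral of the projected right-hand side\<close>

section \<open>Mass conservation\<close>

lemma set_integral_mean_free_part:
  assumes "A \<in> sets M" "emeasure M A < \<infinity>" "set_integrable M A u"
  shows "(LINT x:A|M. mean_free_part M A u x) = 0"
proof -
  let ?I = "LINT x:A|M. u x"
  have c: "set_integrable M A (\<lambda>_. 1 / measure M A * ?I)"
    using assms by (simp add: set_integrable_def)
  have "(LINT x:A|M. mean_free_part M A u x) = ?I - measure M A * (1 / measure M A * ?I)"
    using assms c unfolding mean_free_part_def
    by (subst set_integral_diff) (auto simp: set_lebesgue_integral_def)
  also have "\<dots> = 0"
  \<comment> \<open>Since division by 0 yields 0, the subtracted mean vanishes in this case and the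
    integral itself must be shown to be 0. Finiteness of \<open>emeasure M A\<close> ensures that
    \<open>A\<close> is a genuine null set.\<close>
  proof (cases "measure M A = 0")
    case True
    then have "A \<in> null_sets M"
      using assms by (auto simp: measure_def enn2real_eq_0_iff)
    then have "AE x in M. x \<notin> A"
      by (rule AE_not_in)
    then have "?I = (LINT x|M. 0)"
      unfolding set_lebesgue_integral_def using assms(3)
      by (intro integral_cong_AE) (auto simp: set_integrable_def)
    with True show ?thesis
      by simp
  qed simp
  finally show ?thesis .
qed

text \<open>Integrability of the potential \<open>w\<close> is extracted from the flow equation: on
  \<open>A\<close>, \<open>w\<close> is a multiple of the continuous time derivative plus a
  constant. This also serves the surface potential, which is given only by its formula.\<close>

lemma projected_gradient_flow_mass_conserved:
  fixes u :: "real \<Rightarrow> 'a::metric_space \<Rightarrow> real"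
  assumes M: "sets M = sets borel" "A \<in> sets M" "emeasure M A < \<infinity>"
    and K: "compact K" "A \<subseteq> K" and u: "C1_in_time T K u" and t: "t \<in> {0<..<T}" and "\<gamma> > 0"
    and flow: "\<And>x. x \<in> A \<Longrightarrow> deriv (\<lambda>s. u s x) t = - \<gamma> * mean_free_part M A w x"
  shows "((\<lambda>s. LINT x:A|M. u s x) has_real_derivative 0) (at t)"
proof -
  let ?v = "\<lambda>x. deriv (\<lambda>s. u s x) t"
  \<comment> \<open>No circularity arises: the integral is a fixed real number whether or not
    \<open>w\<close> is integrable.\<close>
  define c where "c = 1 / measure M A * (LINT y:A|M. w y)"
  have "set_integrable M A (\<lambda>x. - (1 / \<gamma>) * ?v x + c)"
    using C1_in_time_continuous_on(2)[OF u t] M K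
    by (intro set_integrable_continuous_on_finite_measure[of _ _ K] continuous_intros)
  moreover have "w x = - (1 / \<gamma>) * ?v x + c" if "x \<in> A" for x
    using flow[OF that] \<open>\<gamma> > 0\<close> by (simp add: mean_free_part_def c_def)
  ultimately have "set_integrable M A w"
    by (metis (no_types, lifting) set_integrable_cong)
  then have "(LINT x:A|M. - \<gamma> * mean_free_part M A w x) = 0"
    using set_integral_mean_free_part[of A M w] M by (simp only: set_integral_mult_right mult_zero_right)
  moreover have "(LINT x:A|M. ?v x) = (LINT x:A|M. - \<gamma> * mean_free_part M A w x)"
    using flow M by (intro set_lebesgue_integral_cong) auto
  ultimately show ?thesis
    using has_real_derivative_set_integral_C1_in_time[OF M K u t] by simp
qed

theorem theorem1:
  fixes \<Omega> :: "'a::euclidean_space set"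
    and T \<gamma>\<^sub>1 \<gamma>\<^sub>2 \<kappa> \<gamma>\<^sub>s \<theta>\<^sub>s :: real
    and G :: "real \<Rightarrow> real"
    and \<phi> \<psi> \<mu> \<mu>\<^sub>\<Gamma> :: "real \<Rightarrow> 'a \<Rightarrow> real"
  assumes "C2_bounded_domain \<Omega>"
    and "T > 0" "\<gamma>\<^sub>1 > 0" "\<gamma>\<^sub>2 > 0" "\<kappa> > 0"
    and "G = double_well \<or> G = contact_line_potential \<gamma>\<^sub>s \<theta>\<^sub>s"
    and "classical_regularity \<Omega> T \<phi> \<psi> \<mu>"
    and "\<And>t x. t \<in> {0<..<T} \<Longrightarrow> x \<in> \<Omega> \<Longrightarrow>
           deriv (\<lambda>s. \<phi> s x) t = - \<gamma>\<^sub>1 * bulk_projection \<Omega> (\<mu> t) x"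
    and "\<And>t x. t \<in> {0<..<T} \<Longrightarrow> x \<in> \<Omega> \<Longrightarrow>
           \<mu> t x = - \<kappa>\<^sup>2 * laplacian (\<phi> t) x + deriv double_well (\<phi> t x)"
    and "\<And>t x. t \<in> {0<..<T} \<Longrightarrow> x \<in> frontier \<Omega> \<Longrightarrow> normal_deriv \<Omega> (\<mu> t) x = 0"
    and "\<And>t x. t \<in> {0<..<T} \<Longrightarrow> x \<in> frontier \<Omega> \<Longrightarrow> \<phi> t x = \<psi> t x"
    and "\<And>t x. t \<in> {0<..<T} \<Longrightarrow> x \<in> frontier \<Omega> \<Longrightarrow>
           deriv (\<lambda>s. \<psi> s x) t = - \<gamma>\<^sub>2 * surface_projection \<Omega> (\<mu>\<^sub>\<Gamma> t) x"
    and "\<And>t x. t \<in> {0<..<T} \<Longrightarrow> x \<in> frontier \<Omega> \<Longrightarrow>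
           \<mu>\<^sub>\<Gamma> t x = - \<kappa>\<^sup>2 * laplace_beltrami \<Omega> (\<psi> t) x + deriv G (\<psi> t x)
                     + \<kappa>\<^sup>2 * normal_deriv \<Omega> (\<phi> t) x"
  shows "\<forall>t\<in>{0<..<T}.
           ((\<lambda>s. LINT x:\<Omega>|lborel. \<phi> s x) has_real_derivative 0) (at t) \<and>
           ((\<lambda>s. LINT x:frontier \<Omega>|surface_measure. \<psi> s x) has_real_derivative 0) (at t)"
proof (intro ballI conjI)
  fix t assume t: "t \<in> {0<..<T}"
  have \<Omega>: "open \<Omega>" "bounded \<Omega>"
    using assms(1) by (auto simp: C2_bounded_domain_def)
  have C1: "C1_in_time T (closure \<Omega>) \<phi>" "C1_in_time T (frontier \<Omega>) \<psi>"
    using assms(7) by (auto simp: classical_regularity_def)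
  \<comment> \<open>The flow equation holds on the open set \<Omega>, while compactness and
    continuity come from its closure.\<close>
  show "((\<lambda>s. LINT x:\<Omega>|lborel. \<phi> s x) has_real_derivative 0) (at t)"
    using \<Omega> t assms(3) assms(8)[OF t]
    by (intro projected_gradient_flow_mass_conserved[OF _ _ _ _ closure_subset C1(1)])
      (auto dest: emeasure_bounded_finite)
  \<comment> \<open>On the surface the compact frontier plays both roles, and its finite Hausdorff
    measure enters here.\<close>
  show "((\<lambda>s. LINT x:frontier \<Omega>|surface_measure. \<psi> s x) has_real_derivative 0) (at t)"
    using \<Omega> t assms(4) assms(12)[OF t] emeasure_surface_measure_frontier_finite[OF assms(1)]
    by (intro projected_gradient_flow_mass_conserved[OF _ _ _ _ order_refl C1(2)])
      (auto simp: compact_frontier_bounded)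
qed

end
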